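(* Let $U, V_1,\dots,V_p$, $A$, $R_i$, $R_i^*$, $f$, $u^0$, $\bm V$, $\bm C,\bm B,\bm C_0,\bm B_0$ be as in the context, with in particular $U=\sum_{i=1}^p R_i^*V_i$ and $R_iR_i^*>0$ for $i=1,\dots,p$. Let $\mu,\sigma>0$ be constants with $$\mu\ge\frac p2,\qquad \sigma\ge\frac p4 .$$ Then the three-level scheme $$\bm C_0\Big(\mu\frac{\bm w^{n+1}-\bm w^n}{\tau}+(1-\mu)\frac{\bm w^n-\bm w^{n-1}}{\tau}\Big)+(\bm C-\bm C_0)\frac{\bm w^n-\bm w^{n-1}}{\tau}+\bm B_0\big(\sigma\bm w^{n+1}+(1-2\sigma)\bm w^n+\sigma\bm w^{n-1}\big)+(\bm B-\bm B_0)\bm w^n=\bm f^n,$$ $n=1,\dots,N-1$, with initial data $\bm w^0=\bm v^0$, $\bm w^1=\widetilde{\bm v}^1$ ($\widetilde{\bm v}^1\in\bm V$ given), is unconditionally stable. That is, for every time step $\tau>0$ (with $N\tau=T$), the operator $$\bm D=\tau\Big(\mu\bm C_0-\frac12\bm C\Big)+\tau^2\Big(\sigma\bm B_0-\frac14\bm B\Big)$$ satisfies $\bm D=\bm D^*\ge0$, and the approximate solution $y^n=\sum_{i=1}^pR_i^*w_i^n$, $y^{n+1/2}=\frac12(y^{n+1}+y^n)$, satisfies for all $n=1,\dots,N-1$ $$\|y^{n+1/2}\|_A^2\le\|y^{1/2}\|_A^2+\Big(\bm D\,\frac{\widetilde{\bm v}^1-\bm v^0}{\tau},\frac{\widetilde{\bm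 v}^1-\bm v^0}{\tau}\Big)+\frac12\sum_{k=1}^n\tau\|f^k\|^2 .$$
   Context: $U$ is a finite-dimensional real Hilbert space with scalar product $(\cdot,\cdot)$ and norm $\|\cdot\|$. $A:U\to U$ is a linear operator, independent of $t$, self-adjoint and positive definite ($A=A^*>0$); $\|u\|_A=(Au,u)^{1/2}$. The problem being approximated is the Cauchy problem $\frac{du}{dt}+Au=f(t)$, $0<t\le T$, $u(0)=u^0\in U$, with given $f:[0,T]\to U$. $V_1,\dots,V_p$ ($p\ge1$) are finite-dimensional real Hilbert spaces with scalar products $(\cdot,\cdot)_i$; $R_i:U\to V_i$ are linear operators with adjoints $R_i^*:V_i\to U$. It is assumed that $U=\sum_{i=1}^pR_i^*V_i$, i.e. every $u\in U$ can be written (not necessarily uniquely) as $u=\sum_iR_i^*v_i$ with $v_i\in V_i$. $\bm V=V_1\oplus\dots\oplus V_p$ with scalar product $(\bm v,\bm z)=\sum_{i=1}^p(v_i,z_i)_i$ for $\bm v=\{v_1,\dots,v_p\}$, $\bm z=\{z_1,\dots,z_p\}$. On $\bm V$ define the operator matrices $$\bm C=\{R_iR_j^*\}_{i,j=1}^p,\quad \bm B=\{R_iAR_j^*\}_{i,j=1}^p,$$ $$\bm C_0=\mathrm{diag}\{R_1R_1^*,\dots,R_pR_p^*\},\quad \bm B_0=\mathrm{diag}\{R_1AR_1^*,\dots,R_pAR_p^*\}.$$ Time grid: $t^n=n\tau$, $n=0,\dots,N$, $N\tau=T$; $f^n=f(t^n)$; $\bm f^n=\{R_1f^n,\dots,R_pf^n\}\in\bm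 V$. The vector $\bm v^0=\{v_1^0,\dots,v_p^0\}\in\bm V$ is a (possibly non-unique) solution of $\sum_{j=1}^pR_iR_j^*v_j^0=R_iu^0$, $i=1,\dots,p$. Components of $\bm w^n\in\bm V$ are denoted $w_i^n$. For self-adjoint operators, $>0$ and $\ge0$ mean positive definite and non-negative. *)

theory Defs
  imports "HOL-Analysis.Analysis"
begin

text \<open>
  The space \<open>U\<close> is a type of class \<^class>\<open>real_inner\<close> that is finite-dimensional. The spaces
  \<open>V i\<close>, which may have different dimensions, are finite-dimensional subspaces of one common inner
  product space and carry its inner product; any finite family of finite-dimensional Hilbert spaces
  is of this form up to isometry. The index type \<open>'p\<close> has \<open>p = CARD('p)\<close> elements.
\<close>

definition finite_dim_subspace :: "'a::real_vector set \<Rightarrow> bool" where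
  "finite_dim_subspace S \<longleftrightarrow> (\<exists>B. finite B \<and> span B = S)"

definition self_adjoint_on :: "'a::real_inner set \<Rightarrow> ('a \<Rightarrow> 'a) \<Rightarrow> bool" where
  "self_adjoint_on S L \<longleftrightarrow> L ` S \<subseteq> S \<and> (\<forall>x\<in>S. \<forall>y\<in>S. L x \<bullet> y = x \<bullet> L y)"

definition positive_definite_on :: "'a::real_inner set \<Rightarrow> ('a \<Rightarrow> 'a) \<Rightarrow> bool" where
  "positive_definite_on S L \<longleftrightarrow> self_adjoint_on S L \<and> (\<forall>x\<in>S. x \<noteq> 0 \<longrightarrow> L x \<bullet> x > 0)"

definition nonnegative_on :: "'a::real_inner set \<Rightarrow> ('a \<Rightarrow> 'a) \<Rightarrow> bool" where
  "nonnegative_on S L \<longleftrightarrow> self_adjoint_on S L \<and> (\<forall>x\<in>S. L x \<bullet> x \<ge> 0)"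

definition norm_op :: "('u::real_inner \<Rightarrow> 'u) \<Rightarrow> 'u \<Rightarrow> real" where
  "norm_op A u = sqrt (A u \<bullet> u)"

text \<open>
  The inner product of \<open>'v ^ 'p\<close> is the sum of the componentwise inner products, so
  \<open>direct_sum V\<close> is the orthogonal direct sum of the \<open>V i\<close>.
\<close>

definition direct_sum :: "('p::finite \<Rightarrow> 'v set) \<Rightarrow> ('v ^ 'p) set" where
  "direct_sum V = {v. \<forall>i. v $ i \<in> V i}"

text \<open>
  For \<open>R i\<close> with values in \<open>V i\<close>, the restriction of \<open>adjoint (R i)\<close> to \<open>V i\<close> is the adjoint of
  \<open>R i\<close> as an operator from \<open>U\<close> to \<open>V i\<close>; below it is only applied to elements of \<open>V i\<close>.
\<close>

definition synth :: "('p::finite \<Rightarrow> 'u::real_inner \<Rightarrow> 'v::real_inner) \<Rightarrow> 'v ^ 'p \<Rightarrow> 'u" where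
  "synth R v = (\<Sum>i\<in>UNIV. adjoint (R i) (v $ i))"

definition op_C :: "('p::finite \<Rightarrow> 'u::real_inner \<Rightarrow> 'v::real_inner) \<Rightarrow> 'v ^ 'p \<Rightarrow> 'v ^ 'p" where
  "op_C R v = (\<chi> i. \<Sum>j\<in>UNIV. R i (adjoint (R j) (v $ j)))"

definition op_B ::
    "('u \<Rightarrow> 'u) \<Rightarrow> ('p::finite \<Rightarrow> 'u::real_inner \<Rightarrow> 'v::real_inner) \<Rightarrow> 'v ^ 'p \<Rightarrow> 'v ^ 'p" where
  "op_B A R v = (\<chi> i. \<Sum>j\<in>UNIV. R i (A (adjoint (R j) (v $ j))))"

definition op_C0 :: "('p::finite \<Rightarrow> 'u::real_inner \<Rightarrow> 'v::real_inner) \<Rightarrow> 'v ^ 'p \<Rightarrow> 'v ^ 'p" where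
  "op_C0 R v = (\<chi> i. R i (adjoint (R i) (v $ i)))"

definition op_B0 ::
    "('u \<Rightarrow> 'u) \<Rightarrow> ('p::finite \<Rightarrow> 'u::real_inner \<Rightarrow> 'v::real_inner) \<Rightarrow> 'v ^ 'p \<Rightarrow> 'v ^ 'p" where
  "op_B0 A R v = (\<chi> i. R i (A (adjoint (R i) (v $ i))))"

definition op_D ::
    "real \<Rightarrow> real \<Rightarrow> real \<Rightarrow> ('u \<Rightarrow> 'u) \<Rightarrow> ('p::finite \<Rightarrow> 'u::real_inner \<Rightarrow> 'v::real_inner)
      \<Rightarrow> 'v ^ 'p \<Rightarrow> 'v ^ 'p" where
  "op_D \<mu> \<sigma> \<tau> A R v =
     \<tau> *\<^sub>R (\<mu> *\<^sub>R op_C0 R v - (1/2) *\<^sub>R op_C R v)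
     + \<tau>\<^sup>2 *\<^sub>R (\<sigma> *\<^sub>R op_B0 A R v - (1/4) *\<^sub>R op_B A R v)"

definition three_level_scheme ::
    "real \<Rightarrow> real \<Rightarrow> real \<Rightarrow> nat \<Rightarrow> ('u \<Rightarrow> 'u) \<Rightarrow> ('p::finite \<Rightarrow> 'u::real_inner \<Rightarrow> 'v::real_inner)
      \<Rightarrow> (real \<Rightarrow> 'u) \<Rightarrow> (nat \<Rightarrow> 'v ^ 'p) \<Rightarrow> bool" where
  "three_level_scheme \<mu> \<sigma> \<tau> N A R f w \<longleftrightarrow>
     (\<forall>n\<in>{1..<N}.
        op_C0 R (\<mu> *\<^sub>R ((w (n + 1) - w n) /\<^sub>R \<tau>) + (1 - \<mu>) *\<^sub>R ((w n - w (n - 1)) /\<^sub>R \<tau>))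
        + (op_C R ((w n - w (n - 1)) /\<^sub>R \<tau>) - op_C0 R ((w n - w (n - 1)) /\<^sub>R \<tau>))
        + op_B0 A R (\<sigma> *\<^sub>R w (n + 1) + (1 - 2 * \<sigma>) *\<^sub>R w n + \<sigma> *\<^sub>R w (n - 1))
        + (op_B A R (w n) - op_B0 A R (w n))
        = (\<chi> i. R i (f (real n * \<tau>))))"

end

theory Submission
  imports Defs
begin

text \<open>
  With \<open>d n = w (n + 1) - w n\<close> and \<open>y = synth R \<circ> w\<close>, the scheme reads
  \<open>D (d n - d (n - 1)) / \<tau>\<^sup>2 + C (d n + d (n - 1)) / (2 * \<tau>) + B (w (n + 1) + 2 * w n + w (n - 1)) / 4 = F\<close>
  with components \<open>F $ i = R i (f n)\<close>, so that \<open>(F, z) = (f n, synth R z)\<close>.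
  Taking the inner product with \<open>d n + d (n - 1)\<close> turns the first and last terms on the left into
  increments of \<open>(D (d n / \<tau>), d n / \<tau>)\<close> and of the squared \<open>A\<close>-norm of \<open>(y (n + 1) + y n) / 2\<close>, and
  the middle one into \<open>(norm s)\<^sup>2 / (2 * \<tau>)\<close> with \<open>s = y (n + 1) - y (n - 1)\<close>. That term absorbs
  \<open>(f n, s)\<close> at the cost of \<open>\<tau> / 2 * (norm (f n))\<^sup>2\<close>. Nonnegativity of \<open>D\<close> follows from
  \<open>C \<le> p C0\<close> and \<open>B \<le> p B0\<close>, which are the Cauchy-Schwarz inequality for sums of \<open>p\<close> terms.
\<close>

text \<open>\<open>adjoint\<close> is a choice term, so the identity needs a witness. Over an
  orthogonal set \<open>C\<close> spanning the domain, the coefficients of the adjoint image of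
  \<open>y\<close> must be \<open>L c \<bullet> y / (c \<bullet> c)\<close>; this is
  \<open>G y\<close>.\<close>

lemma adjoint_works_finite_dim:
  fixes L :: "'u::real_inner \<Rightarrow> 'v::real_inner"
  assumes fin: "finite_dim_subspace (UNIV :: 'u set)" and L: "linear L"
  shows "L x \<bullet> y = x \<bullet> adjoint L y"
proof -
  obtain B :: "'u set" where "finite B" "span B = UNIV"
    using fin by (auto simp: finite_dim_subspace_def)
  then obtain C :: "'u set" where C: "finite C" "span C = UNIV" "pairwise orthogonal C"
    using basis_orthogonal by metis
  define G where "G y = (\<Sum>c\<in>C. (L c \<bullet> y / (c \<bullet> c)) *\<^sub>R c)" for y
  have "L x \<bullet> y = x \<bullet> G y" for x y
  proof -
    have "x \<in> span C" using C by simp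
    then show ?thesis
    proof (induction rule: span_induct_alt)
      case base
      show ?case using L by (simp add: linear_0)
    next
      case (step a b u)
      have "b \<bullet> G y = (\<Sum>c\<in>C. if c = b then L b \<bullet> y else 0)"
        unfolding G_def inner_sum_right
      proof (rule sum.cong[OF refl])
        fix c assume "c \<in> C"
        \<comment> \<open>\<open>C\<close> may contain 0; for \<open>c = b = 0\<close> both sides
          vanish, since \<open>L 0 = 0\<close>.\<close>
        then show "b \<bullet> (L c \<bullet> y / (c \<bullet> c)) *\<^sub>R c = (if c = b then L b \<bullet> y else 0)"
          using C(3) step(1) L
          by (auto simp: pairwise_def orthogonal_def inner_commute linear_0)
      qed
      also have "\<dots> = L b \<bullet> y" using C(1) step(1) by simp
      finally show ?case
        using step L by (simp add: linear_add linear_scale inner_add_left)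
    qed
  qed
  then have "\<forall>x y. L x \<bullet> y = x \<bullet> G y" by blast
  then have "\<forall>x y. L x \<bullet> y = x \<bullet> adjoint L y"
    unfolding adjoint_def
    by (rule someI[of "\<lambda>L'. \<forall>x y. L x \<bullet> y = x \<bullet> L' y"])
  then show ?thesis by blast
qed

text \<open>Each cross term of the double sum is at most the mean of two diagonal terms, because the
  form is nonnegative at \<open>x - y\<close>. It is used with the identity for C and with
  \<open>A\<close> for B.\<close>

lemma sum_form_le_card:
  fixes a :: "'p::finite \<Rightarrow> 'u::real_inner"
  assumes L: "linear L" and sym: "\<And>x y. L x \<bullet> y = x \<bullet> L y" and nonneg: "\<And>x. 0 \<le> L x \<bullet> x"
  shows "L (\<Sum>i\<in>UNIV. a i) \<bullet> (\<Sum>i\<in>UNIV. a i) \<le> real CARD('p) * (\<Sum>i\<in>UNIV. L (a i) \<bullet> a i)"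
proof -
  have "L x \<bullet> y \<le> (L x \<bullet> x + L y \<bullet> y) / 2" for x y
    using nonneg[of "x - y"] sym[of y x]
    by (simp add: linear_diff[OF L] inner_diff_left inner_diff_right inner_commute)
  then have "L (\<Sum>i\<in>UNIV. a i) \<bullet> (\<Sum>i\<in>UNIV. a i)
      \<le> (\<Sum>i\<in>UNIV. \<Sum>j\<in>UNIV. (L (a i) \<bullet> a i + L (a j) \<bullet> a j) / 2)"
    unfolding linear_sum[OF L] inner_sum_left inner_sum_right
    by (subst sum.swap) (intro sum_mono, simp)
  also have "\<dots> = real CARD('p) * (\<Sum>i\<in>UNIV. L (a i) \<bullet> a i)"
    by (simp add: add_divide_distrib sum.distrib flip: sum_divide_distrib sum_distrib_left)
  finally show ?thesis .
qed

text \<open>Difference of squares for a symmetric form: the cross terms cancel.\<close>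

lemma form_diff_eq:
  assumes L: "linear L" and sym: "\<And>x y. L x \<bullet> y = x \<bullet> L y"
  shows "L x \<bullet> x - L y \<bullet> y = L (x - y) \<bullet> (x + y)"
  using sym[of x y]
  by (simp add: linear_diff[OF L] inner_diff_left inner_diff_right inner_add_left inner_add_right
      inner_commute)

text \<open>The adjoint identity is postulated for every \<open>b\<close> of the ambient space, so
  the computations run in \<open>'v ^ 'p\<close> without tracking membership in
  \<open>V i\<close>.\<close>

locale splitting =
  fixes A :: "'u::real_inner \<Rightarrow> 'u"
    and R :: "'p::finite \<Rightarrow> 'u \<Rightarrow> 'v::real_inner"
  assumes linear_A: "linear A"
    and A_sym: "A x \<bullet> y = x \<bullet> A y"
    and A_nonneg: "0 \<le> A x \<bullet> x"
    and linear_R: "linear (R i)"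
    and R_adjoint: "R i x \<bullet> b = x \<bullet> adjoint (R i) b"
begin

lemma linear_adjoint: "linear (adjoint (R i))"
proof (rule linearI)
  fix b c :: 'v and r :: real
  show "adjoint (R i) (b + c) = adjoint (R i) b + adjoint (R i) c"
    by (rule vector_eq_rdot[THEN iffD1]) (metis R_adjoint inner_add_right inner_commute)
  show "adjoint (R i) (r *\<^sub>R b) = r *\<^sub>R adjoint (R i) b"
    by (rule vector_eq_rdot[THEN iffD1]) (metis R_adjoint inner_scaleR_right inner_commute)
qed

lemmas linear_parts =
  linear_adjoint[THEN linear_add] linear_adjoint[THEN linear_scale]
  linear_R[THEN linear_add] linear_R[THEN linear_scale]
  linear_A[THEN linear_add] linear_A[THEN linear_scale]

lemma linear_synth: "linear (synth R)"
  by (rule linearI) (simp_all add: synth_def linear_parts sum.distrib scaleR_right.sum)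

lemma linear_op_C: "linear (op_C R)"
  by (rule linearI) (simp_all add: op_C_def vec_eq_iff linear_parts sum.distrib scaleR_right.sum)

lemma linear_op_B: "linear (op_B A R)"
  by (rule linearI) (simp_all add: op_B_def vec_eq_iff linear_parts sum.distrib scaleR_right.sum)

lemma linear_op_C0: "linear (op_C0 R)"
  by (rule linearI) (simp_all add: op_C0_def vec_eq_iff linear_parts)

lemma linear_op_B0: "linear (op_B0 A R)"
  by (rule linearI) (simp_all add: op_B0_def vec_eq_iff linear_parts)

lemma linear_op_D: "linear (op_D \<mu> \<sigma> \<tau> A R)"
  unfolding op_D_def
  by (intro linear_compose_add linear_compose_sub linear_compose_scale_right
      linear_op_C linear_op_B linear_op_C0 linear_op_B0)

text \<open>\<open>synth R\<close> is the adjoint of the map from \<open>u\<close> to the vector of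
  all \<open>R i u\<close>. Hence C and B are the pullbacks along \<open>synth R\<close> of the
  identity and of \<open>A\<close>.\<close>

lemma inner_R: "(\<chi> i. R i u) \<bullet> z = u \<bullet> synth R z"
  by (simp add: inner_vec_def synth_def R_adjoint inner_sum_right)

lemma inner_op_C: "op_C R v \<bullet> z = synth R v \<bullet> synth R z"
  using inner_R[of "synth R v" z]
  by (simp add: op_C_def synth_def linear_sum[OF linear_R])

lemma inner_op_B: "op_B A R v \<bullet> z = A (synth R v) \<bullet> synth R z"
  using inner_R[of "A (synth R v)" z]
  by (simp add: op_B_def synth_def linear_sum[OF linear_R] linear_sum[OF linear_A])

lemma inner_op_C0:
  "op_C0 R v \<bullet> z = (\<Sum>i\<in>UNIV. adjoint (R i) (v $ i) \<bullet> adjoint (R i) (z $ i))"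
  by (simp add: inner_vec_def op_C0_def R_adjoint)

lemma inner_op_B0:
  "op_B0 A R v \<bullet> z = (\<Sum>i\<in>UNIV. A (adjoint (R i) (v $ i)) \<bullet> adjoint (R i) (z $ i))"
  by (simp add: inner_vec_def op_B0_def R_adjoint)

lemma inner_op_D:
  "op_D \<mu> \<sigma> \<tau> A R v \<bullet> z =
     \<tau> * (\<mu> * (op_C0 R v \<bullet> z) - op_C R v \<bullet> z / 2)
     + \<tau>\<^sup>2 * (\<sigma> * (op_B0 A R v \<bullet> z) - op_B A R v \<bullet> z / 4)"
  by (simp add: op_D_def inner_add_left inner_diff_left)

lemma op_D_sym: "op_D \<mu> \<sigma> \<tau> A R v \<bullet> z = v \<bullet> op_D \<mu> \<sigma> \<tau> A R z"
proof -
  have A_swap: "A x \<bullet> y = A y \<bullet> x" for x y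
    by (metis A_sym inner_commute)
  have "op_C0 R v \<bullet> z = op_C0 R z \<bullet> v" "op_C R v \<bullet> z = op_C R z \<bullet> v"
    unfolding inner_op_C0 inner_op_C by (simp_all only: inner_commute)
  moreover have "op_B0 A R v \<bullet> z = op_B0 A R z \<bullet> v" "op_B A R v \<bullet> z = op_B A R z \<bullet> v"
    by (simp_all only: inner_op_B0 inner_op_B A_swap)
  ultimately show ?thesis
    by (simp add: inner_commute[of v] inner_op_D)
qed

lemma op_D_nonneg:
  assumes "real CARD('p) / 2 \<le> \<mu>" "real CARD('p) / 4 \<le> \<sigma>" "0 \<le> \<tau>"
  shows "0 \<le> op_D \<mu> \<sigma> \<tau> A R v \<bullet> v"
proof -
  have C: "op_C R v \<bullet> v \<le> real CARD('p) * (op_C0 R v \<bullet> v)"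
    unfolding inner_op_C inner_op_C0 synth_def
    by (rule sum_form_le_card[OF linear_id, unfolded id_apply]) auto
  have B: "op_B A R v \<bullet> v \<le> real CARD('p) * (op_B0 A R v \<bullet> v)"
    unfolding inner_op_B inner_op_B0 synth_def
    by (rule sum_form_le_card[OF linear_A A_sym A_nonneg])
  \<comment> \<open>The thresholds are the factor p of \<open>C\<close> and \<open>B\<close> times
    the weights 1/2 and 1/4 in D.\<close>
  have "real CARD('p) / 2 * (op_C0 R v \<bullet> v) \<le> \<mu> * (op_C0 R v \<bullet> v)"
    using assms by (intro mult_right_mono) (auto simp: inner_op_C0 intro: sum_nonneg)
  moreover have "real CARD('p) / 4 * (op_B0 A R v \<bullet> v) \<le> \<sigma> * (op_B0 A R v \<bullet> v)"
    using assms by (intro mult_right_mono) (auto simp: inner_op_B0 A_nonneg intro: sum_nonneg)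
  ultimately show ?thesis
    unfolding inner_op_D using C B assms by (intro add_nonneg_nonneg mult_nonneg_nonneg) auto
qed

text \<open>\<open>E v w\<close> is the energy at the half level between two adjacent time levels;
  the bound is in a form that telescopes.\<close>

lemma energy_step:
  fixes w0 w1 w2 :: "'v ^ 'p" and \<mu> \<sigma> \<tau> :: real
  defines "E \<equiv> \<lambda>v w. (norm_op A ((1/2) *\<^sub>R (synth R w + synth R v)))\<^sup>2
    + op_D \<mu> \<sigma> \<tau> A R ((w - v) /\<^sub>R \<tau>) \<bullet> ((w - v) /\<^sub>R \<tau>)"
  assumes \<tau>: "0 < \<tau>"
    and scheme: "op_C0 R (\<mu> *\<^sub>R ((w2 - w1) /\<^sub>R \<tau>) + (1 - \<mu>) *\<^sub>R ((w1 - w0) /\<^sub>R \<tau>))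
        + (op_C R ((w1 - w0) /\<^sub>R \<tau>) - op_C0 R ((w1 - w0) /\<^sub>R \<tau>))
        + op_B0 A R (\<sigma> *\<^sub>R w2 + (1 - 2 * \<sigma>) *\<^sub>R w1 + \<sigma> *\<^sub>R w0)
        + (op_B A R w1 - op_B0 A R w1) = (\<chi> i. R i g)"
  shows "E w1 w2 \<le> E w0 w1 + \<tau> / 2 * (norm g)\<^sup>2"
proof -
  define x where "x = w2 - w1"
  define y where "y = w1 - w0"
  define z where "z = x + y"
  let ?D = "op_D \<mu> \<sigma> \<tau> A R"
  \<comment> \<open>The weighted mean is \<open>w1\<close> plus \<sigma> times the second
    difference; its \<open>w1\<close> part cancels against \<open>- op_B0 A R w1\<close> in the
    scheme.\<close>
  have combination: "\<sigma> *\<^sub>R w2 + (1 - 2 * \<sigma>) *\<^sub>R w1 + \<sigma> *\<^sub>R w0 = w1 + \<sigma> *\<^sub>R (x - y)"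
    by (simp add: x_def y_def algebra_simps flip: scaleR_2)
  have tested: "(\<mu> * (op_C0 R x \<bullet> z) + (1 - \<mu>) * (op_C0 R y \<bullet> z) + op_C R y \<bullet> z - op_C0 R y \<bullet> z) / \<tau>
      + \<sigma> * (op_B0 A R x \<bullet> z - op_B0 A R y \<bullet> z) + op_B A R w1 \<bullet> z = g \<bullet> synth R z"
    using arg_cong[OF scheme, of "\<lambda>F. F \<bullet> z"]
    unfolding combination inner_R
    by (simp add: linear_op_C0[THEN linear_add] linear_op_C0[THEN linear_scale]
        linear_op_C0[THEN linear_diff] linear_op_C[THEN linear_scale] linear_op_B0[THEN linear_add]
        linear_op_B0[THEN linear_diff] linear_op_B0[THEN linear_scale]
        inner_add_left inner_diff_left divide_inverse algebra_simps flip: x_def y_def)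
  have "?D (x /\<^sub>R \<tau>) \<bullet> (x /\<^sub>R \<tau>) - ?D (y /\<^sub>R \<tau>) \<bullet> (y /\<^sub>R \<tau>) = (?D x \<bullet> x - ?D y \<bullet> y) / \<tau>\<^sup>2"
    by (simp add: linear_op_D[THEN linear_scale] power2_eq_square divide_inverse left_diff_distrib)
  also have "\<dots> = (?D x \<bullet> z - ?D y \<bullet> z) / \<tau>\<^sup>2"
    by (simp add: form_diff_eq[OF linear_op_D op_D_sym] linear_op_D[THEN linear_diff]
        inner_diff_left z_def)
  also have "\<dots> = (\<mu> * (op_C0 R x \<bullet> z - op_C0 R y \<bullet> z) - (op_C R x \<bullet> z - op_C R y \<bullet> z) / 2) / \<tau>
      + \<sigma> * (op_B0 A R x \<bullet> z - op_B0 A R y \<bullet> z) - (op_B A R x \<bullet> z - op_B A R y \<bullet> z) / 4"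
    using \<tau> by (simp add: inner_op_D field_simps power2_eq_square)
  finally have D_diff: "?D (x /\<^sub>R \<tau>) \<bullet> (x /\<^sub>R \<tau>) - ?D (y /\<^sub>R \<tau>) \<bullet> (y /\<^sub>R \<tau>) = \<dots>" .
  have norm_half: "(norm_op A ((1/2) *\<^sub>R u))\<^sup>2 = A u \<bullet> u / 4" for u
    by (simp add: norm_op_def A_nonneg linear_scale[OF linear_A])
  have synth_w: "synth R w2 = synth R w1 + synth R x" "synth R w0 = synth R w1 - synth R y"
    "synth R z = synth R x + synth R y"
    by (simp_all add: x_def y_def z_def linear_diff[OF linear_synth] linear_add[OF linear_synth])
  have sum_w: "a + b + a + (a + (a - c)) = 4 *\<^sub>R a + b - c" for a b c :: 'u
    using scaleR_add_left[of 2 2 a] by (simp add: scaleR_2 algebra_simps)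
  have "(norm_op A ((1/2) *\<^sub>R (synth R w2 + synth R w1)))\<^sup>2
      - (norm_op A ((1/2) *\<^sub>R (synth R w1 + synth R w0)))\<^sup>2
      = A (synth R z) \<bullet> (4 *\<^sub>R synth R w1 + synth R x - synth R y) / 4"
    unfolding norm_half diff_divide_distrib[symmetric] form_diff_eq[OF linear_A A_sym]
    by (simp add: synth_w sum_w)
  \<comment> \<open>The quarter of the second difference produced here cancels the B term of
    \<open>D_diff\<close>.\<close>
  also have "\<dots> = op_B A R w1 \<bullet> z + (op_B A R x \<bullet> z - op_B A R y \<bullet> z) / 4"
    unfolding A_sym by (subst inner_commute)
      (simp add: inner_op_B linear_add[OF linear_A] linear_diff[OF linear_A]
        linear_scale[OF linear_A] inner_add_left inner_diff_left)
  finally have A_diff: "(norm_op A ((1/2) *\<^sub>R (synth R w2 + synth R w1)))\<^sup>2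
      - (norm_op A ((1/2) *\<^sub>R (synth R w1 + synth R w0)))\<^sup>2 = \<dots>" .
  have C_sum: "op_C R x \<bullet> z + op_C R y \<bullet> z = (norm (synth R z))\<^sup>2"
    by (simp add: inner_op_C z_def linear_add[OF linear_synth] power2_norm_eq_inner
        inner_add_left)
  \<comment> \<open>The weight \<tau> makes the quadratic term, after division by
    \<open>2 * \<tau>\<close>, equal to the dissipation.\<close>
  have "(norm (synth R z - \<tau> *\<^sub>R g))\<^sup>2
      = (norm (synth R z))\<^sup>2 - 2 * \<tau> * (g \<bullet> synth R z) + \<tau>\<^sup>2 * (norm g)\<^sup>2"
    unfolding power2_norm_eq_inner
    by (simp add: inner_diff_left inner_diff_right inner_commute power2_eq_square)
  then have "0 \<le> ((norm (synth R z))\<^sup>2 - 2 * \<tau> * (g \<bullet> synth R z) + \<tau>\<^sup>2 * (norm g)\<^sup>2) / (2 * \<tau>)"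
    using \<tau> by (metis divide_nonneg_pos mult_pos_pos zero_le_power2 zero_less_numeral)
  also have "\<dots> = (norm (synth R z))\<^sup>2 / (2 * \<tau>) + \<tau> / 2 * (norm g)\<^sup>2 - g \<bullet> synth R z"
    using \<tau> by (simp add: add_divide_distrib diff_divide_distrib power2_eq_square)
  finally have young: "g \<bullet> synth R z \<le> (norm (synth R z))\<^sup>2 / (2 * \<tau>) + \<tau> / 2 * (norm g)\<^sup>2"
    by simp
  \<comment> \<open>\<open>tested\<close> contains C y / \<tau> and \<open>D_diff\<close> contains
    -(C x - C y) / (2 \<tau>); they differ by (C x + C y) / (2 \<tau>), which \<open>C_sum\<close>
    evaluates.\<close>
  have "E w1 w2 - E w0 w1 = g \<bullet> synth R z - (norm (synth R z))\<^sup>2 / (2 * \<tau>)"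
    using tested D_diff A_diff unfolding E_def x_def[symmetric] y_def[symmetric] C_sum[symmetric]
    by (simp add: algebra_simps add_divide_distrib diff_divide_distrib)
  then show ?thesis using young by simp
qed

text \<open>The D term stays on the left so that the steps telescope. Starting the induction at
  \<open>n = 0\<close> makes the base case trivial, and the step to \<open>Suc n\<close> uses the
  scheme at level \<open>Suc n\<close>.\<close>

lemma energy_estimate:
  fixes w :: "nat \<Rightarrow> 'v ^ 'p"
  assumes \<tau>: "0 < \<tau>" and scheme: "three_level_scheme \<mu> \<sigma> \<tau> N A R f w" and "n < N"
  shows "(norm_op A ((1/2) *\<^sub>R (synth R (w (n + 1)) + synth R (w n))))\<^sup>2
      + op_D \<mu> \<sigma> \<tau> A R ((w (n + 1) - w n) /\<^sub>R \<tau>) \<bullet> ((w (n + 1) - w n) /\<^sub>R \<tau>)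
      \<le> (norm_op A ((1/2) *\<^sub>R (synth R (w 1) + synth R (w 0))))\<^sup>2
      + op_D \<mu> \<sigma> \<tau> A R ((w 1 - w 0) /\<^sub>R \<tau>) \<bullet> ((w 1 - w 0) /\<^sub>R \<tau>)
      + (1/2) * (\<Sum>k=1..n. \<tau> * (norm (f (real k * \<tau>)))\<^sup>2)"
  using \<open>n < N\<close>
proof (induction n)
  case 0
  show ?case by simp
next
  case (Suc n)
  have "Suc n \<in> {1..<N}" using Suc.prems by simp
  from energy_step[OF \<tau> scheme[unfolded three_level_scheme_def, rule_format, OF this]] Suc
  show ?case by (simp add: algebra_simps)
qed

end

theorem theorem1:
  fixes A :: "'u::real_inner \<Rightarrow> 'u"
    and R :: "'p::finite \<Rightarrow> 'u \<Rightarrow> 'v::real_inner"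
    and V :: "'p \<Rightarrow> 'v set"
    and f :: "real \<Rightarrow> 'u"
    and u0 :: 'u
    and \<mu> \<sigma> \<tau> T :: real
    and N :: nat
  assumes U_fin: "finite_dim_subspace (UNIV :: 'u set)"
    and A_lin: "linear A"
    and A_pos: "positive_definite_on UNIV A"
    and V_fin: "\<And>i. finite_dim_subspace (V i)"
    and R_lin: "\<And>i. linear (R i)"
    and R_into: "\<And>i u. R i u \<in> V i"
    and U_sum: "\<And>u. \<exists>v\<in>direct_sum V. u = (\<Sum>i\<in>UNIV. adjoint (R i) (v $ i))"
    and RR_pos: "\<And>i. positive_definite_on (V i) (\<lambda>v. R i (adjoint (R i) v))"
    and mu_pos: "\<mu> > 0" and sigma_pos: "\<sigma> > 0"
    and mu: "\<mu> \<ge> real CARD('p) / 2"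
    and sigma: "\<sigma> \<ge> real CARD('p) / 4"
    and T_pos: "T > 0" and tau_pos: "\<tau> > 0" and grid: "real N * \<tau> = T"
  shows "nonnegative_on (direct_sum V) (op_D \<mu> \<sigma> \<tau> A R) \<and>
    (\<forall>v0\<in>direct_sum V. \<forall>v1\<in>direct_sum V. \<forall>w :: nat \<Rightarrow> 'v ^ 'p.
       (\<forall>i. (\<Sum>j\<in>UNIV. R i (adjoint (R j) (v0 $ j))) = R i u0) \<longrightarrow>
       (\<forall>n\<le>N. w n \<in> direct_sum V) \<longrightarrow>
       w 0 = v0 \<longrightarrow> w 1 = v1 \<longrightarrow>
       three_level_scheme \<mu> \<sigma> \<tau> N A R f w \<longrightarrow>
       (\<forall>n\<in>{1..<N}.
          (norm_op A ((1/2) *\<^sub>R (synth R (w (n + 1)) + synth R (w n))))\<^sup>2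
          \<le> (norm_op A ((1/2) *\<^sub>R (synth R (w 1) + synth R (w 0))))\<^sup>2
             + op_D \<mu> \<sigma> \<tau> A R ((v1 - v0) /\<^sub>R \<tau>) \<bullet> ((v1 - v0) /\<^sub>R \<tau>)
             + (1/2) * (\<Sum>k=1..n. \<tau> * (norm (f (real k * \<tau>)))\<^sup>2)))"
proof (intro conjI ballI allI impI)
  interpret splitting A R
  proof
    show "A x \<bullet> y = x \<bullet> A y" for x y
      using A_pos by (simp add: positive_definite_on_def self_adjoint_on_def)
    show "0 \<le> A x \<bullet> x" for x
      using A_pos by (cases "x = 0") (auto simp: positive_definite_on_def intro: less_imp_le)
  qed (simp_all add: A_lin R_lin linear_add linear_scale adjoint_works_finite_dim[OF U_fin R_lin])
  have V_sub: "subspace (V i)" for i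
    using V_fin[of i] subspace_span by (metis finite_dim_subspace_def)
  \<comment> \<open>Component \<open>i\<close> is a linear combination of values of
    \<open>R i\<close>, which lie in \<open>V i\<close> by \<open>R_into\<close>.\<close>
  have "op_D \<mu> \<sigma> \<tau> A R v \<in> direct_sum V" for v
    unfolding op_D_def op_C_def op_B_def op_C0_def op_B0_def direct_sum_def
    by (auto intro!: subspace_add[OF V_sub] subspace_diff[OF V_sub] subspace_scale[OF V_sub]
        subspace_sum[OF V_sub] R_into)
  then show "nonnegative_on (direct_sum V) (op_D \<mu> \<sigma> \<tau> A R)"
    using op_D_nonneg[OF mu sigma] tau_pos
    by (auto simp: nonnegative_on_def self_adjoint_on_def op_D_sym)
  fix v0 v1 :: "'v ^ 'p" and w :: "nat \<Rightarrow> 'v ^ 'p" and n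
  assume w: "w 0 = v0" "w 1 = v1" "three_level_scheme \<mu> \<sigma> \<tau> N A R f w" and "n \<in> {1..<N}"
  then have "n < N" by simp
  \<comment> \<open>Nonnegativity of D allows its term at level \<open>n\<close> to be dropped from
    the left.\<close>
  from energy_estimate[OF tau_pos w(3) this]
    op_D_nonneg[OF mu sigma, of \<tau> "(w (n + 1) - w n) /\<^sub>R \<tau>"] tau_pos
  show "(norm_op A ((1/2) *\<^sub>R (synth R (w (n + 1)) + synth R (w n))))\<^sup>2
      \<le> (norm_op A ((1/2) *\<^sub>R (synth R (w 1) + synth R (w 0))))\<^sup>2
        + op_D \<mu> \<sigma> \<tau> A R ((v1 - v0) /\<^sub>R \<tau>) \<bullet> ((v1 - v0) /\<^sub>R \<tau>)
        + (1/2) * (\<Sum>k=1..n. \<tau> * (norm (f (real k * \<tau>)))\<^sup>2)"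
    unfolding w(1)[symmetric] w(2)[symmetric] by linarith
qed

end
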